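(* For every integer $n\ge 2$ and every integer $k$, $$s_k(n+1)=s_{k-1}(n)+2s_k(n)-s_{k}(n-1).$$
   Context: A honeycomb strip of length $n$ consists of $n$ hexagons labelled $1,\dots,n$ arranged in two rows, in which hexagon $i$ is adjacent (shares an edge) exactly with hexagons $i\pm1$ and $i\pm 2$ (when these exist); equivalently its inner dual is the graph $P_n^2$ on vertices $1,\dots,n$ with $i\sim j$ iff $1\le |i-j|\le 2$. A division into $k$ pieces is a partition of the hexagons into $k$ blocks, each block connected (i.e., inducing a connected subgraph of $P_n^2$). Let $s_k(n)$ be the number of divisions of the honeycomb strip of length $n$ into exactly $k$ pieces such that the last two hexagons $n-1$ and $n$ lie in different pieces (with $s_k(1)=0$, and $s_k(n)=0$ for $k\le 0$). *)

theory Defs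
  imports "HOL-Library.Disjoint_Sets" "Graph_Theory.Graph_Theory"
begin

text \<open>The inner dual \<open>P\<^sub>n\<^sup>2\<close> of the honeycomb strip of length \<open>n\<close>, as a symmetric loop-free
  digraph (lemma \<open>strip_dual_graph\<close>).\<close>

definition strip_dual :: "nat \<Rightarrow> nat pair_pre_digraph" where
  "strip_dual n = \<lparr> pverts = {1..n},
     parcs = {(i, j). i \<in> {1..n} \<and> j \<in> {1..n} \<and>
                      1 \<le> \<bar>int i - int j\<bar> \<and> \<bar>int i - int j\<bar> \<le> 2} \<rparr>"

definition is_division :: "nat \<Rightarrow> nat set set \<Rightarrow> bool" where
  "is_division n P \<longleftrightarrow>
     partition_on {1..n} P \<and>
     (\<forall>B\<in>P. Digraph_Component.connected (with_proj (strip_dual n) \<restriction> B))"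

text \<open>For \<open>n \<le> 1\<close> the truncated \<open>n - 1\<close> is \<open>0\<close>, which is no hexagon and lies in no block, so the
  predicate below is false and the convention \<open>s\<^sub>k(1) = 0\<close> is met (lemma \<open>s_one\<close>).\<close>

definition last_two_separated :: "nat \<Rightarrow> nat set set \<Rightarrow> bool" where
  "last_two_separated n P \<longleftrightarrow> (\<exists>A\<in>P. \<exists>B\<in>P. A \<noteq> B \<and> n - 1 \<in> A \<and> n \<in> B)"

definition s :: "int \<Rightarrow> nat \<Rightarrow> nat" where
  "s k n = card {P. is_division n P \<and> int (card P) = k \<and> last_two_separated n P}"

lemma strip_dual_graph: "graph (with_proj (strip_dual n))"
proof
  have "parcs (strip_dual n) \<subseteq> {1..n} \<times> {1..n}"
    by (auto simp: strip_dual_def)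
  then show "finite (arcs (with_proj (strip_dual n)))"
    by (auto intro: finite_subset)
  show "symmetric (with_proj (strip_dual n))"
    by (auto simp: symmetric_def sym_def arcs_ends_conv strip_dual_def image_iff)
qed (auto simp: strip_dual_def arc_to_ends_def)

lemma finite_divisions: "finite {P. is_division n P}"
proof (rule finite_subset)
  show "{P. is_division n P} \<subseteq> Pow (Pow {1..n})"
    by (auto simp: is_division_def partition_on_def)
qed auto

lemma s_one: "s k 1 = 0"
proof -
  have no: "\<not> (is_division 1 P \<and> int (card P) = k \<and> last_two_separated 1 P)" for P
  proof
    assume "is_division 1 P \<and> int (card P) = k \<and> last_two_separated 1 P"
    then obtain A where "A \<in> P" "0 \<in> A" "\<Union>P = {1..1}"
      by (auto simp: is_division_def last_two_separated_def partition_on_def)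
    then show False
      by (metis UnionI atLeastAtMost_iff not_one_le_zero)
  qed
  show ?thesis
    by (simp only: s_def no) simp
qed

lemma s_nonpos:
  assumes "k \<le> 0"
  shows "s k n = 0"
proof -
  have no: "\<not> (is_division n P \<and> int (card P) = k \<and> last_two_separated n P)" for P
  proof
    assume P: "is_division n P \<and> int (card P) = k \<and> last_two_separated n P"
    then have "finite P"
      using finite_elements[of "{1..n}" P] by (auto simp: is_division_def)
    with P assms show False
      by (auto simp: last_two_separated_def)
  qed
  show ?thesis
    by (simp only: s_def no) simp
qed

end

theory Submission
  imports Defs
begin

text \<open>
  Deleting hexagon \<open>m + 1\<close> from a division of the strip of length \<open>m + 1\<close> leaves a division of the
  strip of length \<open>m\<close>, because the neighbours \<open>m - 1\<close> and \<open>m\<close> of \<open>m + 1\<close> are themselves adjacent.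
  Let \<open>d\<^sub>k(m)\<close> be the number of all divisions into \<open>k\<close> pieces. If \<open>m\<close> and \<open>m + 1\<close> are
  separated, then \<open>m + 1\<close> is either a piece on its own or lies in the piece of \<open>m - 1\<close>, so
  \<open>s\<^sub>k(m + 1) = d\<^sub>k\<^sub>-\<^sub>1(m) + s\<^sub>k(m)\<close>; otherwise it lies in the piece of \<open>m\<close>, so
  \<open>d\<^sub>k(m + 1) = s\<^sub>k(m + 1) + d\<^sub>k(m)\<close>. Eliminating \<open>d\<close> gives the recurrence.
\<close>

section \<open>Connected pieces of the strip\<close>

text \<open>Connectedness in \<open>P\<^sub>n\<^sup>2\<close> put combinatorially: two consecutive
  hexagons missing below a larger element cut a piece. The condition does not mention
  \<open>n\<close>, so a piece keeps it when the strip is lengthened. The empty set satisfies it, so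
  nonemptiness is tracked separately.\<close>

definition gap_free :: "nat set \<Rightarrow> bool" where
  "gap_free B \<longleftrightarrow> (\<forall>a\<in>B. \<forall>b\<in>B. a < b \<longrightarrow> a + 1 \<in> B \<or> a + 2 \<in> B)"

text \<open>An edge spans at most 2, so no path crosses two consecutive missing hexagons.
  Conversely, without such a gap one climbs from the smaller to the larger element in steps of 1 or
  2, and symmetry gives the way down.\<close>

lemma connected_strip_dual_iff:
  assumes "B \<subseteq> {1..n}"
  shows "Digraph_Component.connected (with_proj (strip_dual n) \<restriction> B) \<longleftrightarrow> B \<noteq> {} \<and> gap_free B"
proof -
  define R where "R = {(i, j). i \<in> B \<and> j \<in> B \<and> i \<noteq> j \<and> i \<le> j + 2 \<and> j \<le> i + 2}"
  have "arcs (with_proj (strip_dual n) \<restriction> B) = R"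
    using assms by (auto simp: R_def strip_dual_def)
  \<comment> \<open>\<open>connected\<close> refers to the symmetric closure; as \<open>R\<close> is
    already symmetric, the closure is \<open>R\<close> itself.\<close>
  then have "parcs (mk_symmetric (with_proj (strip_dual n) \<restriction> B)) = (\<Union>(i, j)\<in>R. {(i, j), (j, i)})"
    by (auto simp: parcs_mk_symmetric)
  also have "\<dots> = R"
    by (auto simp: R_def)
  finally have "arcs_ends (with_proj (mk_symmetric (with_proj (strip_dual n) \<restriction> B))) = R"
    by (simp add: arcs_ends_conv)
  then have "Digraph_Component.connected (with_proj (strip_dual n) \<restriction> B) \<longleftrightarrow>
      B \<noteq> {} \<and> (\<forall>u\<in>B. \<forall>v\<in>B. (u, v) \<in> rtrancl_on B R)"
    unfolding Digraph_Component.connected_def strongly_connected_def reachable_def by simp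
  moreover have "(\<forall>u\<in>B. \<forall>v\<in>B. (u, v) \<in> rtrancl_on B R) \<longleftrightarrow> gap_free B"
  proof
    assume conn: "\<forall>u\<in>B. \<forall>v\<in>B. (u, v) \<in> rtrancl_on B R"
    show "gap_free B"
      unfolding gap_free_def
    proof (intro ballI impI, rule ccontr)
      fix a b
      assume ab: "a \<in> B" "b \<in> B" "a < b" and gap: "\<not> (a + 1 \<in> B \<or> a + 2 \<in> B)"
      have "(a, b) \<in> rtrancl_on B R"
        using conn ab by blast
      \<comment> \<open>Induction along the path: a step from some \<open>y \<le> a\<close> reaches
        at most \<open>a + 2\<close>, and \<open>a + 1\<close> and \<open>a + 2\<close> are
        missing.\<close>
      then have "b \<le> a"
      proof (induction rule: rtrancl_on_induct)
        case (step y z)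
        then have "z \<le> a + 2" "z \<noteq> a + 1" "z \<noteq> a + 2"
          using gap by (auto simp: R_def)
        then show ?case
          by linarith
      qed simp
      with ab show False
        by simp
    qed
  next
    assume gf: "gap_free B"
    have up: "(u, v) \<in> rtrancl_on B R" if "u \<in> B" "v \<in> B" "u \<le> v" for u v
      using that
    proof (induction "v - u" arbitrary: u rule: less_induct)
      case less
      show ?case
      proof (cases "u = v")
        case True
        with less.prems show ?thesis
          by simp
      next
        case False
        \<comment> \<open>The next stepping stone. Trying \<open>u + 1\<close> first prevents
          overshooting: \<open>u + 2\<close> is used only if \<open>u + 1\<close> is missing, and
          then \<open>v\<close> is not \<open>u + 1\<close>.\<close>
        define w where "w = (if u + 1 \<in> B then u + 1 else u + 2)"
        have "u < v"
          using False less.prems by simp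
        then have "w \<in> B"
          using gf less.prems unfolding gap_free_def w_def by auto
        moreover have "v \<noteq> u + 1" if "u + 1 \<notin> B"
          using that less.prems by blast
        then have "w \<le> v"
          using \<open>u < v\<close> by (auto simp: w_def)
        ultimately have w: "w \<in> B" "u < w" "w \<le> u + 2" "w \<le> v"
          by (simp_all add: w_def)
        then have "(w, v) \<in> rtrancl_on B R"
          using less by simp
        moreover have "(u, w) \<in> R"
          using w less.prems by (simp add: R_def)
        ultimately show ?thesis
          using less.prems converse_rtrancl_on_into_rtrancl_on by metis
      qed
    qed
    have "sym (rtrancl_on B R)"
      by (rule rtrancl_on_sym) (auto simp: sym_def R_def)
    with up show "\<forall>u\<in>B. \<forall>v\<in>B. (u, v) \<in> rtrancl_on B R"
      by (meson nle_le symE)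
  qed
  ultimately show ?thesis
    by simp
qed

text \<open>Blocks of a partition are nonempty, so the graph disappears from the argument
  here.\<close>

lemma is_division_iff:
  "is_division n P \<longleftrightarrow> partition_on {1..n} P \<and> (\<forall>B\<in>P. gap_free B)"
proof (cases "partition_on {1..n} P")
  case True
  then have "B \<subseteq> {1..n}" "B \<noteq> {}" if "B \<in> P" for B
    using that by (auto simp: partition_on_def)
  with True show ?thesis
    by (auto simp: is_division_def connected_strip_dual_iff)
qed (simp add: is_division_def)

text \<open>The maximum of \<open>B\<close> must reach \<open>Suc m\<close> in one step, hence is
  \<open>m\<close> or \<open>m - 1\<close>. Dropping \<open>Suc m\<close> breaks nothing, because
  \<open>m - 1\<close> and \<open>m\<close> are adjacent themselves.\<close>

lemma gap_free_insert_iff: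
  assumes "B \<subseteq> {1..m}" "B \<noteq> {}"
  shows "gap_free (insert (Suc m) B) \<longleftrightarrow> gap_free B \<and> (m \<in> B \<or> m - 1 \<in> B)"
proof
  assume gf: "gap_free (insert (Suc m) B)"
  have fin: "finite B"
    using assms finite_subset by blast
  have "Max B \<in> B" "Max B < Suc m"
    using fin assms Max_in[OF fin] by auto
  then have "Max B + 1 \<in> insert (Suc m) B \<or> Max B + 2 \<in> insert (Suc m) B"
    using gf unfolding gap_free_def by blast
  moreover have "Max B + 1 \<notin> B" "Max B + 2 \<notin> B"
    using Max_ge[OF fin, of "Max B + 1"] Max_ge[OF fin, of "Max B + 2"] by linarith+
  ultimately have "Max B = m \<or> Max B = m - 1"
    by auto
  then have "m \<in> B \<or> m - 1 \<in> B"
    using \<open>Max B \<in> B\<close> by auto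
  moreover have "gap_free B"
    unfolding gap_free_def
  proof (intro ballI impI)
    fix a b
    assume ab: "a \<in> B" "b \<in> B" "a < b"
    then have "a + 1 \<in> insert (Suc m) B \<or> a + 2 \<in> insert (Suc m) B"
      using gf unfolding gap_free_def by blast
    moreover have "b \<le> m"
      using ab assms by auto
    \<comment> \<open>The one case where \<open>Suc m\<close> might have served as the successor of
      \<open>a\<close>: then \<open>a = m - 1\<close>, and the larger element
      \<open>b \<le> m\<close> must be \<open>m\<close>.\<close>
    moreover have "a + 1 \<in> B" if "a + 2 = Suc m"
    proof -
      have "a + 1 = b"
        using that ab \<open>b \<le> m\<close> by linarith
      with ab show ?thesis
        by simp
    qed
    ultimately show "a + 1 \<in> B \<or> a + 2 \<in> B"
      using ab by auto
  qed
  ultimately show "gap_free B \<and> (m \<in> B \<or> m - 1 \<in> B)"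
    by simp
next
  assume gf: "gap_free B \<and> (m \<in> B \<or> m - 1 \<in> B)"
  show "gap_free (insert (Suc m) B)"
    unfolding gap_free_def
  proof (intro ballI impI)
    fix a b
    assume ab: "a \<in> insert (Suc m) B" "b \<in> insert (Suc m) B" "a < b"
    have le: "x \<le> m" "1 \<le> x" if "x \<in> B" for x
      using that assms by auto
    have a: "a \<in> B"
      using ab le(1)[of b] by auto
    show "a + 1 \<in> insert (Suc m) B \<or> a + 2 \<in> insert (Suc m) B"
    \<comment> \<open>Without such a \<open>c\<close>, \<open>a\<close> is the maximum of
      \<open>B\<close>, so it is \<open>m\<close> or \<open>m - 1\<close> and \<open>Suc m\<close>
      is within reach.\<close>
    proof (cases "\<exists>c\<in>B. a < c")
      case True
      with a gf show ?thesis
        unfolding gap_free_def by auto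
    next
      case False
      then have "m \<le> a + 1"
        using gf by auto
      with le(1)[OF a] have "a = m \<or> a + 2 = Suc m"
        by linarith
      then show ?thesis
        by auto
    qed
  qed
qed

section \<open>Adding a point to a block of a partition\<close>

lemma partition_on_block_eq:
  "partition_on A P \<Longrightarrow> X \<in> P \<Longrightarrow> Y \<in> P \<Longrightarrow> z \<in> X \<Longrightarrow> z \<in> Y \<Longrightarrow> X = Y"
  by (auto simp: partition_on_def disjoint_def)

text \<open>The receiving block is named by a member \<open>c\<close>, so one fixed map serves all
  partitions at once, as the bijections below require.\<close>

definition add_with :: "'a \<Rightarrow> 'a \<Rightarrow> 'a set set \<Rightarrow> 'a set set" where
  "add_with c x P = (\<lambda>X. if c \<in> X then insert x X else X) ` P"

text \<open>A block \<open>{x}\<close> would leave the empty set behind, so this is meant for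
  partitions in which \<open>x\<close> shares its block.\<close>

definition remove_elem :: "'a \<Rightarrow> 'a set set \<Rightarrow> 'a set set" where
  "remove_elem x P = (\<lambda>X. X - {x}) ` P"

text \<open>Since \<open>x\<close> lies in no block of \<open>P\<close>, deleting it undoes the
  insertion block by block; this left inverse also shows that no two blocks merge.\<close>

lemma add_with:
  assumes P: "partition_on A P" and x: "x \<notin> A" and c: "c \<in> A"
  shows "partition_on (insert x A) (add_with c x P)"
    and "remove_elem x (add_with c x P) = P"
    and "card (add_with c x P) = card P"
proof -
  let ?f = "\<lambda>X. if c \<in> X then insert x X else X"
  have un: "\<Union>P = A"
    using P by (simp add: partition_on_def)
  have inv: "?f X - {x} = X" if "X \<in> P" for X
    using that un x by auto
  show "remove_elem x (add_with c x P) = P"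
    unfolding remove_elem_def add_with_def image_image using inv by simp
  show "card (add_with c x P) = card P"
    unfolding add_with_def
    by (rule card_image, rule inj_on_inverseI[where g = "\<lambda>X. X - {x}"]) (rule inv)
  show "partition_on (insert x A) (add_with c x P)"
  proof (rule partition_onI)
    obtain C where "C \<in> P" "c \<in> C"
      using c un by blast
    then show "\<Union>(add_with c x P) = insert x A"
      unfolding un[symmetric] add_with_def by (auto split: if_splits)
    show "{} \<notin> add_with c x P"
      using P by (auto simp: add_with_def partition_on_def split: if_splits)
    fix X' Y'
    assume "X' \<in> add_with c x P" "Y' \<in> add_with c x P" and ne: "X' \<noteq> Y'"
    then obtain X Y where X: "X \<in> P" "X' = ?f X" and Y: "Y \<in> P" "Y' = ?f Y"
      unfolding add_with_def by blast
    have "X \<inter> Y = {}"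
      using X Y ne partition_on_block_eq[OF P] by fastforce
    moreover have "x \<notin> X" "x \<notin> Y"
      using X Y un x by auto
    ultimately show "disjnt X' Y'"
      unfolding X(2) Y(2) by (auto simp: disjnt_def)
  qed
qed

text \<open>\<open>B\<close> is the only block containing \<open>x\<close> and the only one
  containing \<open>c\<close>, so inserting \<open>x\<close> next to \<open>c\<close> restores
  \<open>Q\<close>. No block becomes empty, since \<open>B\<close> keeps \<open>c\<close>, which
  differs from \<open>x\<close>.\<close>

lemma remove_elem:
  assumes Q: "partition_on (insert x A) Q" and x: "x \<notin> A"
    and B: "B \<in> Q" "x \<in> B" "c \<in> B" "c \<in> A"
  shows "partition_on A (remove_elem x Q)"
    and "add_with c x (remove_elem x Q) = Q"
    and "card (remove_elem x Q) = card Q"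
proof -
  let ?f = "\<lambda>X. if c \<in> X then insert x X else X"
  have un: "\<Union>Q = insert x A"
    using Q by (simp add: partition_on_def)
  have inv: "?f (X - {x}) = X" if "X \<in> Q" for X
  proof -
    have "c \<in> X \<longleftrightarrow> X = B" "x \<in> X \<longleftrightarrow> X = B"
      using partition_on_block_eq[OF Q that B(1)] B by auto
    then show ?thesis
      using B x by auto
  qed
  show "add_with c x (remove_elem x Q) = Q"
    unfolding remove_elem_def add_with_def image_image using inv by simp
  show "card (remove_elem x Q) = card Q"
    unfolding remove_elem_def
    by (rule card_image, rule inj_on_inverseI[where g = ?f]) (rule inv)
  show "partition_on A (remove_elem x Q)"
  proof (rule partition_onI)
    show "\<Union>(remove_elem x Q) = A"
      using un x by (auto simp: remove_elem_def)
    show "{} \<notin> remove_elem x Q"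
    proof
      assume "{} \<in> remove_elem x Q"
      then obtain X where X: "X \<in> Q" "X \<subseteq> {x}"
        by (auto simp: remove_elem_def)
      moreover have "X \<noteq> {}"
        using X Q by (auto simp: partition_on_def)
      ultimately have "X = B"
        using partition_on_block_eq[OF Q X(1) B(1)] B by auto
      then show False
        using X B x by auto
    qed
    fix X' Y'
    assume "X' \<in> remove_elem x Q" "Y' \<in> remove_elem x Q" and ne: "X' \<noteq> Y'"
    then obtain X Y where X: "X \<in> Q" "X' = X - {x}" and Y: "Y \<in> Q" "Y' = Y - {x}"
      unfolding remove_elem_def by blast
    then have "X \<inter> Y = {}"
      using ne partition_on_block_eq[OF Q] by fastforce
    then show "disjnt X' Y'"
      unfolding X(2) Y(2) by (auto simp: disjnt_def)
  qed
qed

section \<open>Adding the last hexagon\<close>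

lemma atLeastAtMost_1_Suc: "{1..Suc m} = insert (Suc m) {1..m}"
  by auto

lemma is_division_Suc_partition_on:
  "is_division (Suc m) Q \<Longrightarrow> partition_on (insert (Suc m) {1..m}) Q"
  unfolding is_division_def atLeastAtMost_1_Suc by blast

text \<open>The bounds say that \<open>c\<close> is one of the neighbours \<open>m - 1\<close> and
  \<open>m\<close> of \<open>Suc m\<close>, so the enlarged block stays connected.\<close>

lemma is_division_add_with:
  assumes P: "is_division m P" and c: "c \<in> {1..m}" "m \<le> c + 1"
  shows "is_division (Suc m) (add_with c (Suc m) P)"
  unfolding is_division_iff
proof
  have part: "partition_on {1..m} P"
    using P by (simp add: is_division_def)
  then show "partition_on {1..Suc m} (add_with c (Suc m) P)"
    unfolding atLeastAtMost_1_Suc using c by (intro add_with) auto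
  have c': "c = m \<or> c = m - 1"
    using c by auto
  show "\<forall>B\<in>add_with c (Suc m) P. gap_free B"
  proof
    fix B
    assume "B \<in> add_with c (Suc m) P"
    then obtain X where X: "X \<in> P" and B: "B = (if c \<in> X then insert (Suc m) X else X)"
      by (auto simp: add_with_def)
    have "gap_free X" "X \<subseteq> {1..m}" "X \<noteq> {}"
      using X P part by (auto simp: is_division_iff partition_on_def)
    then show "gap_free B"
      unfolding B using c' by (auto simp: gap_free_insert_iff)
  qed
qed

text \<open>The companion \<open>c\<close> keeps the block of \<open>Suc m\<close> nonempty;
  \<open>gap_free_insert_iff\<close> keeps it connected.\<close>

lemma is_division_remove_elem:
  assumes Q: "is_division (Suc m) Q"
    and B: "B \<in> Q" "Suc m \<in> B" "c \<in> B" "c \<in> {1..m}"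
  shows "is_division m (remove_elem (Suc m) Q)"
  unfolding is_division_iff
proof
  have part: "partition_on (insert (Suc m) {1..m}) Q"
    using Q by (rule is_division_Suc_partition_on)
  show part': "partition_on {1..m} (remove_elem (Suc m) Q)"
    by (rule remove_elem[OF part _ B]) simp
  show "\<forall>X\<in>remove_elem (Suc m) Q. gap_free X"
  proof
    fix X'
    assume X': "X' \<in> remove_elem (Suc m) Q"
    then obtain X where X: "X \<in> Q" "X' = X - {Suc m}"
      by (auto simp: remove_elem_def)
    then have gf: "gap_free X"
      using Q by (simp add: is_division_iff)
    have sub: "X' \<subseteq> {1..m}" "X' \<noteq> {}"
      using X' part' by (auto simp: partition_on_def)
    show "gap_free X'"
    proof (cases "Suc m \<in> X")
      case True
      then have "insert (Suc m) X' = X"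
        using X by auto
      with gf gap_free_insert_iff[OF sub] show ?thesis
        by simp
    next
      case False
      with X gf show ?thesis
        by simp
    qed
  qed
qed

text \<open>Every hexagon lies in exactly one block. The bound \<open>n \<ge> 2\<close> accounts for
  truncated subtraction: otherwise \<open>n - 1\<close> is 0, which is in no block.\<close>

lemma last_two_separated_iff:
  assumes "partition_on {1..n} P"
  shows "last_two_separated n P \<longleftrightarrow> n \<ge> 2 \<and> \<not> (\<exists>B\<in>P. n - 1 \<in> B \<and> n \<in> B)"
proof -
  have un: "\<Union>P = {1..n}"
    using assms by (simp add: partition_on_def)
  have "n \<ge> 2" if "A \<in> P" "n - 1 \<in> A" for A
  proof -
    have "n - 1 \<in> {1..n}"
      using that un by blast
    then show ?thesis
      by simp
  qed
  moreover have "\<exists>A\<in>P. n - 1 \<in> A" "\<exists>B\<in>P. n \<in> B" if "n \<ge> 2"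
  proof -
    have "n - 1 \<in> \<Union>P" "n \<in> \<Union>P"
      unfolding un using that by auto
    then show "\<exists>A\<in>P. n - 1 \<in> A" "\<exists>B\<in>P. n \<in> B"
      by auto
  qed
  ultimately show ?thesis
    unfolding last_two_separated_def using partition_on_block_eq[OF assms] by metis
qed

lemma not_last_two_separated_add_with:
  assumes P: "is_division m P" and m: "m \<ge> 1"
  shows "\<not> last_two_separated (Suc m) (add_with m (Suc m) P)"
proof -
  have "m \<in> \<Union>P"
    using P m by (simp add: is_division_def partition_on_def)
  then have "\<exists>B\<in>add_with m (Suc m) P. m \<in> B \<and> Suc m \<in> B"
    by (auto simp: add_with_def)
  moreover have "is_division (Suc m) (add_with m (Suc m) P)"
    using P m by (intro is_division_add_with) auto
  ultimately show ?thesis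
    by (simp add: last_two_separated_iff is_division_def)
qed

text \<open>\<open>Suc m\<close> joins the block of \<open>m - 1\<close>, which avoids
  \<open>m\<close>. That block has a second element, which sets this case apart from
  \<open>Suc m\<close> being a piece on its own.\<close>

lemma last_two_separated_add_with:
  assumes P: "is_division m P" and sep: "last_two_separated m P"
  shows "last_two_separated (Suc m) (add_with (m - 1) (Suc m) P)"
    and "{Suc m} \<notin> add_with (m - 1) (Suc m) P"
proof -
  have part: "partition_on {1..m} P"
    using P by (simp add: is_division_def)
  then have sub: "X \<subseteq> {1..m}" "X \<noteq> {}" if "X \<in> P" for X
    using that by (auto simp: partition_on_def)
  have m: "m \<ge> 2" and nb: "\<not> (\<exists>B\<in>P. m - 1 \<in> B \<and> m \<in> B)"
    using sep part by (simp_all add: last_two_separated_iff)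
  have notin: "Suc m \<notin> X" if "X \<in> P" for X
    using sub[OF that] by auto
  have "partition_on {1..Suc m} (add_with (m - 1) (Suc m) P)"
    unfolding atLeastAtMost_1_Suc using part m by (intro add_with) auto
  moreover have "\<not> (\<exists>B\<in>add_with (m - 1) (Suc m) P. m \<in> B \<and> Suc m \<in> B)"
    using nb notin by (auto simp: add_with_def split: if_splits)
  ultimately show "last_two_separated (Suc m) (add_with (m - 1) (Suc m) P)"
    using m by (simp add: last_two_separated_iff)
  show "{Suc m} \<notin> add_with (m - 1) (Suc m) P"
    using sub notin m by (fastforce simp: add_with_def split: if_splits)
qed

text \<open>The block of \<open>Suc m\<close> has another element, so connectedness puts
  \<open>m\<close> or \<open>m - 1\<close> in it, and separation excludes \<open>m\<close>. That
  \<open>m - 1\<close> is a genuine hexagon rules out a truncated 0.\<close>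

lemma last_block_of_separated:
  assumes Q: "is_division (Suc m) Q" and sep: "last_two_separated (Suc m) Q"
    and ns: "{Suc m} \<notin> Q"
  obtains B where "B \<in> Q" "Suc m \<in> B" "m - 1 \<in> B" "m - 1 \<in> {1..m}" "m \<notin> B"
proof -
  have part: "partition_on {1..Suc m} Q"
    using Q by (simp add: is_division_def)
  then have "Suc m \<in> \<Union>Q"
    by (simp add: partition_on_def)
  then obtain B where B: "B \<in> Q" "Suc m \<in> B"
    by blast
  have m: "m \<notin> B"
    using B sep part by (auto simp: last_two_separated_iff)
  have sub: "B \<subseteq> {1..Suc m}"
    using B part by (auto simp: partition_on_def)
  have "B - {Suc m} \<subseteq> {1..m}" "B - {Suc m} \<noteq> {}"
    using sub B ns by (auto simp: subset_singleton_iff le_Suc_eq)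
  moreover have "gap_free (insert (Suc m) (B - {Suc m}))"
    using Q B by (simp add: is_division_iff insert_absorb)
  ultimately have "m \<in> B - {Suc m} \<or> m - 1 \<in> B - {Suc m}"
    using gap_free_insert_iff by blast
  with m have "m - 1 \<in> B"
    by auto
  moreover from this sub have "m - 1 \<in> {1..m}"
    by auto
  ultimately show thesis
    using that B m by blast
qed

text \<open>The block of \<open>m - 1\<close> is that of \<open>Suc m\<close>, which avoids
  \<open>m\<close>; deletion does not change this.\<close>

lemma last_two_separated_remove_elem:
  assumes Q: "is_division (Suc m) Q" and sep: "last_two_separated (Suc m) Q"
    and ns: "{Suc m} \<notin> Q"
  shows "last_two_separated m (remove_elem (Suc m) Q)"
proof -
  obtain B where B: "B \<in> Q" "Suc m \<in> B" "m - 1 \<in> B" "m - 1 \<in> {1..m}" and m: "m \<notin> B"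
    using last_block_of_separated[OF assms] .
  have part: "partition_on {1..Suc m} Q"
    using Q by (simp add: is_division_def)
  have "partition_on {1..m} (remove_elem (Suc m) Q)"
    using is_division_remove_elem[OF Q B] by (simp add: is_division_def)
  moreover have "\<not> (\<exists>X\<in>remove_elem (Suc m) Q. m - 1 \<in> X \<and> m \<in> X)"
    using partition_on_block_eq[OF part _ B(1) _ B(3)] m by (auto simp: remove_elem_def)
  ultimately show ?thesis
    using B(4) by (auto simp: last_two_separated_iff)
qed

section \<open>Counting\<close>

text \<open>The divisions counted by \<open>d\<^sub>k(m)\<close>; with \<open>k\<close> an integer,
  \<open>k - 1\<close> is never truncated.\<close>

definition divisions :: "int \<Rightarrow> nat \<Rightarrow> nat set set set" where
  "divisions k n = {P. is_division n P \<and> int (card P) = k}"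

lemma finite_divisions_card: "finite (divisions k n)"
  using finite_divisions by (rule rev_finite_subset) (auto simp: divisions_def)

lemma s_eq_card: "s k n = card {P \<in> divisions k n. last_two_separated n P}"
  by (simp add: s_def divisions_def conj_assoc)

text \<open>Here \<open>Suc m\<close> lies in the block of \<open>m\<close>, so deleting it and
  adding it back next to \<open>m\<close> are mutually inverse.\<close>

lemma card_unseparated:
  assumes m: "m \<ge> 1"
  shows "card {Q \<in> divisions k (Suc m). \<not> last_two_separated (Suc m) Q} = card (divisions k m)"
proof (rule bij_betw_same_card[symmetric], rule bij_betw_byWitness)
  let ?S = "divisions k m" and ?T = "{Q \<in> divisions k (Suc m). \<not> last_two_separated (Suc m) Q}"
  let ?f = "add_with m (Suc m)" and ?g = "remove_elem (Suc m)"
  have P: "?f P \<in> ?T \<and> ?g (?f P) = P" if "P \<in> ?S" for P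
  proof -
    have div: "is_division m P" and "partition_on {1..m} P" "int (card P) = k"
      using that by (auto simp: divisions_def is_division_def)
    then show ?thesis
      using add_with[of "{1..m}" P "Suc m" m] is_division_add_with[OF div, of m]
        not_last_two_separated_add_with[OF div m] m
      by (simp add: divisions_def)
  qed
  have Q: "?g Q \<in> ?S \<and> ?f (?g Q) = Q" if "Q \<in> ?T" for Q
  proof -
    have div: "is_division (Suc m) Q" and part: "partition_on (insert (Suc m) {1..m}) Q"
      and k: "int (card Q) = k"
      using that is_division_Suc_partition_on by (auto simp: divisions_def)
    have "\<exists>B\<in>Q. m \<in> B \<and> Suc m \<in> B"
      using that m last_two_separated_iff[of "Suc m" Q] div by (auto simp: is_division_def)
    then obtain B where B: "B \<in> Q" "Suc m \<in> B" "m \<in> B" "m \<in> {1..m}"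
      using m by auto
    show ?thesis
      using remove_elem[OF part _ B] is_division_remove_elem[OF div B] k
      by (simp add: divisions_def)
  qed
  show "\<forall>P\<in>?S. ?g (?f P) = P" "?f ` ?S \<subseteq> ?T"
    using P by blast+
  show "\<forall>Q\<in>?T. ?f (?g Q) = Q" "?g ` ?T \<subseteq> ?S"
    using Q by blast+
qed

text \<open>Here \<open>Suc m\<close> lies in the block of \<open>m - 1\<close>, so the inverse of
  deletion adds it back next to \<open>m - 1\<close>.\<close>

lemma card_separated_joined:
  "card {Q \<in> divisions k (Suc m). last_two_separated (Suc m) Q \<and> {Suc m} \<notin> Q} = s k m"
  unfolding s_eq_card
proof (rule bij_betw_same_card[symmetric], rule bij_betw_byWitness)
  let ?S = "{P \<in> divisions k m. last_two_separated m P}"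
  let ?T = "{Q \<in> divisions k (Suc m). last_two_separated (Suc m) Q \<and> {Suc m} \<notin> Q}"
  let ?f = "add_with (m - 1) (Suc m)" and ?g = "remove_elem (Suc m)"
  have P: "?f P \<in> ?T \<and> ?g (?f P) = P" if "P \<in> ?S" for P
  proof -
    have div: "is_division m P" and part: "partition_on {1..m} P" and k: "int (card P) = k"
      and sep: "last_two_separated m P"
      using that by (auto simp: divisions_def is_division_def)
    have m: "m \<ge> 2"
      using sep part by (simp add: last_two_separated_iff)
    show ?thesis
      using add_with[OF part, of "Suc m" "m - 1"] is_division_add_with[OF div, of "m - 1"]
        last_two_separated_add_with[OF div sep] m k
      by (simp add: divisions_def)
  qed
  have Q: "?g Q \<in> ?S \<and> ?f (?g Q) = Q" if "Q \<in> ?T" for Q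
  proof -
    have div: "is_division (Suc m) Q" and part: "partition_on (insert (Suc m) {1..m}) Q"
      and k: "int (card Q) = k"
      and sep: "last_two_separated (Suc m) Q" "{Suc m} \<notin> Q"
      using that is_division_Suc_partition_on by (auto simp: divisions_def)
    obtain B where B: "B \<in> Q" "Suc m \<in> B" "m - 1 \<in> B" "m - 1 \<in> {1..m}"
      using last_block_of_separated[OF div sep] .
    show ?thesis
      using remove_elem[OF part _ B] is_division_remove_elem[OF div B]
        last_two_separated_remove_elem[OF div sep] k
      by (simp add: divisions_def)
  qed
  show "\<forall>P\<in>?S. ?g (?f P) = P" "?f ` ?S \<subseteq> ?T"
    using P by blast+
  show "\<forall>Q\<in>?T. ?f (?g Q) = Q" "?g ` ?T \<subseteq> ?S"
    using Q by blast+
qed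

text \<open>A singleton piece is connected and separated from \<open>m\<close>, so it may be added
  to or removed from any division, changing the number of pieces by one.\<close>

lemma card_separated_alone:
  assumes m: "m \<ge> 1"
  shows "card {Q \<in> divisions k (Suc m). last_two_separated (Suc m) Q \<and> {Suc m} \<in> Q}
    = card (divisions (k - 1) m)"
proof (rule bij_betw_same_card[symmetric], rule bij_betw_byWitness)
  let ?S = "divisions (k - 1) m"
  let ?T = "{Q \<in> divisions k (Suc m). last_two_separated (Suc m) Q \<and> {Suc m} \<in> Q}"
  let ?f = "insert {Suc m}" and ?g = "\<lambda>Q. Q - {{Suc m}}"
  have part_iff: "partition_on {1..Suc m} (?f P) \<longleftrightarrow> partition_on {1..m} P"
    if "disjnt {Suc m} (\<Union>P)" for P
  proof -
    have "{1..Suc m} - {Suc m} = {1..m}"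
      by auto
    with that show ?thesis
      using partition_on_insert[of "{Suc m}" P "{1..Suc m}"] by simp
  qed
  have P: "?f P \<in> ?T \<and> ?g (?f P) = P" if "P \<in> ?S" for P
  proof -
    have div: "is_division m P" and part: "partition_on {1..m} P" and k: "int (card P) = k - 1"
      using that by (auto simp: divisions_def is_division_def)
    have un: "\<Union>P = {1..m}"
      using part by (simp add: partition_on_def)
    have notin: "Suc m \<notin> X" if "X \<in> P" for X
      using that un by (metis Suc_n_not_le_n UnionI atLeastAtMost_iff)
    then have new: "{Suc m} \<notin> P"
      by blast
    have part': "partition_on {1..Suc m} (?f P)"
      using part_iff[of P] part notin by auto
    have "finite P"
      using part finite_elements by blast
    then have "int (card (?f P)) = k"
      using k new by simp
    moreover have "is_division (Suc m) (?f P)"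
      using part' div by (auto simp: is_division_iff gap_free_def)
    moreover have "last_two_separated (Suc m) (?f P)"
      using part' m notin by (auto simp: last_two_separated_iff)
    ultimately show ?thesis
      using new by (simp add: divisions_def)
  qed
  have Q: "?g Q \<in> ?S \<and> ?f (?g Q) = Q" if "Q \<in> ?T" for Q
  proof -
    have div: "is_division (Suc m) Q" and part: "partition_on {1..Suc m} Q"
      and k: "int (card Q) = k" and single: "{Suc m} \<in> Q"
      using that by (auto simp: divisions_def is_division_def)
    \<comment> \<open>Once the singleton is gone, no remaining block contains \<open>Suc m\<close>,
      as \<open>part_iff\<close> requires.\<close>
    have "X = {Suc m}" if "X \<in> Q" "Suc m \<in> X" for X
      using partition_on_block_eq[OF part that(1) single that(2)] by simp
    then have "disjnt {Suc m} (\<Union>(?g Q))"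
      by auto
    then have "partition_on {1..m} (?g Q)"
      using part_iff[of "?g Q"] part single by (simp add: insert_absorb)
    then have "is_division m (?g Q)"
      using div by (simp add: is_division_iff)
    moreover have "finite Q"
      using part finite_elements by blast
    then have "card Q = Suc (card (?g Q))"
      using single by (metis card_Suc_Diff1)
    ultimately show ?thesis
      using k single by (auto simp: divisions_def)
  qed
  show "\<forall>P\<in>?S. ?g (?f P) = P" "?f ` ?S \<subseteq> ?T"
    using P by blast+
  show "\<forall>Q\<in>?T. ?f (?g Q) = Q" "?g ` ?T \<subseteq> ?S"
    using Q by blast+
qed

section \<open>Recurrences for separated and total counts\<close>

lemma card_filter_split:
  assumes "finite A"
  shows "card A = card {x \<in> A. R x} + card {x \<in> A. \<not> R x}"
proof -
  have "A = {x \<in> A. R x} \<union> {x \<in> A. \<not> R x}"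
    by blast
  then have "card A = card ({x \<in> A. R x} \<union> {x \<in> A. \<not> R x})"
    by simp
  also have "\<dots> = card {x \<in> A. R x} + card {x \<in> A. \<not> R x}"
    using assms by (intro card_Un_disjoint) auto
  finally show ?thesis .
qed

lemma s_Suc:
  assumes "m \<ge> 1"
  shows "s k (Suc m) = card (divisions (k - 1) m) + s k m"
  using card_filter_split[of "{Q \<in> divisions k (Suc m). last_two_separated (Suc m) Q}"
      "\<lambda>Q. {Suc m} \<in> Q"] card_separated_alone[OF assms, of k] card_separated_joined[of k m]
  by (simp add: s_eq_card finite_divisions_card conj_assoc)

lemma card_divisions_Suc:
  assumes "m \<ge> 1"
  shows "card (divisions k (Suc m)) = s k (Suc m) + card (divisions k m)"
  using card_filter_split[OF finite_divisions_card, of k "Suc m" "last_two_separated (Suc m)"]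
    card_unseparated[OF assms, of k]
  by (simp add: s_eq_card)

theorem theorem6:
  fixes n :: nat and k :: int
  assumes "n \<ge> 2"
  shows "int (s k (n + 1)) = int (s (k - 1) n) + 2 * int (s k n) - int (s k (n - 1))"
proof -
  obtain m where n: "n = Suc m" and m: "m \<ge> 1"
    using assms by (cases n) auto
  \<comment> \<open>The three facts read
    \<open>s\<^sub>k(n+1) = d\<^sub>k\<^sub>-\<^sub>1(n) + s\<^sub>k(n)\<close>,
    \<open>s\<^sub>k(n) = d\<^sub>k\<^sub>-\<^sub>1(m) + s\<^sub>k(m)\<close> and
    \<open>d\<^sub>k\<^sub>-\<^sub>1(n) = s\<^sub>k\<^sub>-\<^sub>1(n) +
    d\<^sub>k\<^sub>-\<^sub>1(m)\<close>; the second removes the last remaining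
    \<open>d\<close>.\<close>
  show ?thesis
    using s_Suc[of n k] s_Suc[OF m, of k] card_divisions_Suc[OF m, of "k - 1"] assms
    unfolding n by simp
qed

end
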